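(* Let $d\in\mathbb{N}$ and let $N\subset(0,\infty)$ be such that $\sum_{s\in N}s^d<\infty$. Then there exists some nonempty compact set $C\subset\mathbb{R}^d$ such that $N_C=N$.
   Context: For nonempty compact $C\subset\mathbb{R}^d$ and $r>0$, let $C_r:=\{x\in\mathbb{R}^d: d(x,C)<r\}$, where $d(x,C)=\min_{y\in C}|x-y|$, and $V_C(r):=\lambda_d(C_r)$, where $\lambda_d$ is Lebesgue measure on $\mathbb{R}^d$. $N_C\subset(0,\infty)$ denotes the set of all $s>0$ at which the function $V_C:(0,\infty)\to\mathbb{R}$ is not differentiable. Here $\mathbb{N}=\{1,2,\dots\}$, and $\sum_{s\in N}s^d$ is the supremum of the finite partial sums. *)

theory Defs
  imports "HOL-Analysis.Analysis"
begin

definition parallel_set :: "'a::metric_space set \<Rightarrow> real \<Rightarrow> 'a set" where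
  "parallel_set C r = {x. infdist x C < r}"

definition parallel_volume :: "'a::euclidean_space set \<Rightarrow> real \<Rightarrow> real" where
  "parallel_volume C r = measure lebesgue (parallel_set C r)"

text \<open>The volume function is considered on the open half-line of positive radii.
  Differentiability at a point of that half-line depends only on nearby values, so the filter
  \<open>at s\<close> needs no restriction to it.\<close>

definition nondiff_radii :: "'a::euclidean_space set \<Rightarrow> real set" where
  "nondiff_radii C = {s. 0 < s \<and> \<not> parallel_volume C differentiable (at s)}"

end

theory Submission
  imports Defs
begin

text \<open>
  The set \<open>C\<close> is a large closed ball of radius \<open>R\<close> from which one open box is removed for every
  \<open>s \<in> N\<close>. The box has one edge of length \<open>2 * s\<close>, and all its other edges have length
  \<open>4 * s\<close>. The boxes are pairwise disjoint and their closures lie in the open ball.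

  For \<open>r > 0\<close>, the parallel set of \<open>C\<close> is the open ball of radius \<open>R + r\<close> without the boxes shrunk
  by \<open>r\<close> on every side (\<open>parallel_set_ball_minus_boxes\<close>). The box belonging to \<open>s\<close> therefore
  withholds the volume \<open>2 * (s - r) * (4 * s - 2 * r) ^ (d - 1)\<close> as long as \<open>r \<le> s\<close> and nothing
  afterwards. As a function of \<open>r\<close> this has a kink at \<open>r = s\<close>, because the second factor does not
  vanish there, and it is differentiable elsewhere. A cube of edge length \<open>2 * s\<close> would not do: for
  \<open>d \<ge> 2\<close> its contribution \<open>(2 * s - 2 * r) ^ d\<close> reaches zero with vanishing slope.

  The sum of the \<open>d\<close>-th powers is bounded, so only finitely many \<open>s \<in> N\<close> exceed a given positive
  number. Hence near each \<open>r > 0\<close> the parallel volume is a polynomial minus finitely many such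
  contributions (\<open>parallel_volume_ball_minus_boxes\<close>), only one of which, that of \<open>s = r\<close>, can fail
  to be differentiable at \<open>r\<close> (\<open>not_differentiable_kink\<close>).

  It remains to place the boxes. Each fits into a cube of edge length \<open>4 * s\<close>, and cubes whose total
  volume is finite can be packed into a bounded region (\<open>cube_packing\<close>).
\<close>

section \<open>Parallel sets of a ball with box-shaped holes\<close>

text \<open>
  A point of the hole \<open>box (l s) (u s)\<close> has distance less than \<open>r\<close> from the complement of the hole
  exactly when it is that close to one of the bounding hyperplanes. Its projection onto that
  hyperplane lies in the closed box, hence in no other hole.
\<close>

lemma parallel_set_ball_minus_boxes:
  fixes l u :: "'i \<Rightarrow> 'a::euclidean_space"
  assumes R: "0 \<le> R" and r: "0 < r"
    and sub: "\<And>s. s \<in> A \<Longrightarrow> cbox (l s) (u s) \<subseteq> ball 0 R"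
    and ne: "\<And>s. s \<in> A \<Longrightarrow> box (l s) (u s) \<noteq> {}"
    and disj: "disjoint_family_on (\<lambda>s. box (l s) (u s)) A"
  defines "C \<equiv> cball 0 R - (\<Union>s\<in>A. box (l s) (u s))"
  shows "C \<noteq> {}" and "compact C"
    and "parallel_set C r = ball 0 (R + r) - (\<Union>s\<in>A. cbox (l s + r *\<^sub>R One) (u s - r *\<^sub>R One))"
proof -
  have sphere: "sphere 0 R \<subseteq> C"
    using sub box_subset_cbox by (fastforce simp: C_def)
  then show ne_C: "C \<noteq> {}"
    using R vector_choose_size[of R] by (metis (no_types) dist_0_norm empty_iff mem_sphere subsetD)
  show comp: "compact C"
    unfolding C_def by (intro compact_diff compact_cball open_UN ballI open_box)
  have less_iff: "infdist x C < r \<longleftrightarrow> (\<exists>y\<in>C. dist x y < r)" for x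
  proof
    show "infdist x C < r \<Longrightarrow> \<exists>y\<in>C. dist x y < r"
      using infdist_attains_inf[OF compact_imp_closed[OF comp] ne_C, of x] by metis
    show "\<exists>y\<in>C. dist x y < r \<Longrightarrow> infdist x C < r"
      using infdist_le by (metis order_le_less_trans)
  qed
  show "parallel_set C r = ball 0 (R + r) - (\<Union>s\<in>A. cbox (l s + r *\<^sub>R One) (u s - r *\<^sub>R One))"
    (is "_ = ?rhs")
  proof (intro equalityI subsetI)
    fix x
    assume "x \<in> parallel_set C r"
    then obtain y where y: "y \<in> C" "dist x y < r"
      by (auto simp: parallel_set_def less_iff)
    have "norm x < R + r"
      using y norm_triangle_sub[of x y] by (auto simp: C_def dist_norm)
    moreover have "x \<notin> cbox (l s + r *\<^sub>R One) (u s - r *\<^sub>R One)" if s: "s \<in> A" for s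
    proof
      assume x: "x \<in> cbox (l s + r *\<^sub>R One) (u s - r *\<^sub>R One)"
      have "l s \<bullet> i < y \<bullet> i \<and> y \<bullet> i < u s \<bullet> i" if i: "i \<in> Basis" for i
      proof -
        have "\<bar>x \<bullet> i - y \<bullet> i\<bar> < r"
          using Basis_le_norm[OF i, of "x - y"] y(2) by (simp add: dist_norm inner_diff_left)
        moreover have "l s \<bullet> i + r \<le> x \<bullet> i" "x \<bullet> i \<le> u s \<bullet> i - r"
          using x i by (auto simp: mem_box inner_diff_left inner_add_left)
        ultimately show ?thesis by linarith
      qed
      then have "y \<in> box (l s) (u s)" by (simp add: mem_box)
      with y(1) s show False by (auto simp: C_def)
    qed
    ultimately show "x \<in> ?rhs" by auto
  next
    fix x
    assume x: "x \<in> ?rhs"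
    consider "x \<in> C" | "R < norm x" | s where "s \<in> A" "x \<in> box (l s) (u s)"
      by (fastforce simp: C_def)
    then have "\<exists>y\<in>C. dist x y < r"
    proof cases
      case 1
      then show ?thesis using r by (intro bexI[of _ x]) auto
    next
      case 2
      define y where "y = (R / norm x) *\<^sub>R x"
      have "y \<in> C" using 2 R by (intro subsetD[OF sphere]) (auto simp: y_def)
      moreover have "dist x y < r"
      proof -
        have "x - y = ((norm x - R) / norm x) *\<^sub>R x"
          using 2 R by (auto simp: y_def diff_divide_distrib scaleR_diff_left)
        then have "dist x y = norm x - R"
          using 2 R by (auto simp: dist_norm)
        then show ?thesis using x by simp
      qed
      ultimately show ?thesis by blast
    next
      case (3 s)
      then have "x \<notin> cbox (l s + r *\<^sub>R One) (u s - r *\<^sub>R One)" using x by blast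
      then obtain i where i: "i \<in> Basis" "x \<bullet> i < l s \<bullet> i + r \<or> u s \<bullet> i - r < x \<bullet> i"
        by (auto simp: mem_box inner_diff_left inner_add_left not_le)
      have xi: "l s \<bullet> i < x \<bullet> i" "x \<bullet> i < u s \<bullet> i"
        using 3 i by (auto simp: mem_box)
      obtain t where t: "t = l s \<bullet> i \<or> t = u s \<bullet> i" "\<bar>t - x \<bullet> i\<bar> < r"
        using i(2) xi by (metis abs_of_neg abs_of_pos add.commute diff_gt_0_iff_gt diff_less_eq
            diff_less_0_iff_less minus_diff_eq)
      define y where "y = x + (t - x \<bullet> i) *\<^sub>R i"
      have yj: "y \<bullet> j = (if j = i then t else x \<bullet> j)" if "j \<in> Basis" for j
        using i that by (auto simp: y_def inner_add_left inner_Basis)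
      have y_cbox: "y \<in> cbox (l s) (u s)"
        using 3(2) t(1) xi yj by (auto simp: mem_box)
      have "y \<notin> box (l s) (u s)"
        using t(1) yj[OF i(1)] i(1) by (force simp: mem_box)
      moreover have "y \<notin> box (l s') (u s')" if "s' \<in> A" "s' \<noteq> s" for s'
      proof -
        have "box (l s') (u s') \<inter> box (l s) (u s) = {}"
          using disj that 3(1) by (auto simp: disjoint_family_on_def)
        then have "box (l s') (u s') \<inter> cbox (l s) (u s) = {}"
          using open_Int_closure_eq_empty[OF open_box] closure_box[OF ne[OF 3(1)]] by metis
        then show ?thesis using y_cbox by blast
      qed
      ultimately have "y \<in> C"
        using sub[OF 3(1)] y_cbox by (force simp: C_def)
      moreover have "dist x y < r"
        using t(2) i(1) by (simp add: y_def dist_norm)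
      ultimately show ?thesis by blast
    qed
    then show "x \<in> parallel_set C r" by (simp add: parallel_set_def less_iff)
  qed
qed

section \<open>The parallel volume\<close>

lemma not_differentiable_kink:
  fixes h :: "real \<Rightarrow> real"
  assumes h: "isCont h s" "h s \<noteq> 0"
  shows "\<not> (\<lambda>r. max 0 (s - r) * h r) differentiable (at s)"
proof
  assume "(\<lambda>r. max 0 (s - r) * h r) differentiable (at s)"
  then obtain D where "((\<lambda>r. max 0 (s - r) * h r) has_field_derivative D) (at s)"
    by (auto simp: real_differentiable_def)
  then have lim: "((\<lambda>r. max 0 (s - r) * h r / (r - s)) \<longlongrightarrow> D) (at s)"
    by (simp add: has_field_derivative_iff)
  \<comment> \<open>The right derivative is \<open>0\<close>, the left derivative is \<open>- h s\<close>.\<close>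
  have "((\<lambda>r. max 0 (s - r) * h r / (r - s)) \<longlongrightarrow> 0) (at_right s)"
    by (rule tendsto_eventually) (auto simp: eventually_at_filter)
  then have "D = 0"
    using tendsto_unique[OF _ filterlim_at_split[THEN iffD1, OF lim, THEN conjunct2]] by auto
  have "((\<lambda>r. - h r) \<longlongrightarrow> - h s) (at_left s)"
    using h(1) by (intro tendsto_minus) (auto simp: isCont_def filterlim_at_split)
  moreover have "\<forall>\<^sub>F r in at_left s. - h r = max 0 (s - r) * h r / (r - s)"
    by (auto simp: eventually_at_filter field_simps)
  ultimately have "((\<lambda>r. max 0 (s - r) * h r / (r - s)) \<longlongrightarrow> - h s) (at_left s)"
    by (rule Lim_transform_eventually)
  then have "D = - h s"
    using tendsto_unique[OF _ filterlim_at_split[THEN iffD1, OF lim, THEN conjunct1]] by auto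
  with \<open>D = 0\<close> h(2) show False by simp
qed

text \<open>The components of \<open>One\<close>, in the form into which the simplifier rewrites \<open>One $ i\<close>.\<close>

lemma sum_Basis_cart: "(\<Sum>b\<in>(Basis :: (real ^ 'n) set). b $ i) = 1"
proof -
  have "(One :: real ^ 'n) $ i = 1"
    by (simp add: cart_eq_inner_axis axis_in_Basis_iff del: sum_component)
  then show ?thesis by simp
qed

text \<open>
  The edge vector of the box that is removed for the radius \<open>s\<close>; \<open>i0\<close> is the direction of its short
  edge.
\<close>

definition plate :: "'n \<Rightarrow> real \<Rightarrow> real ^ 'n" where
  "plate i0 s = (\<chi> i. if i = i0 then 2 * s else 4 * s)"

text \<open>
  For \<open>r > s\<close> the shrunken box is empty because of its extent in direction \<open>i0\<close>; the factor
  \<open>max 0 (s - r)\<close> accounts for that case too.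
\<close>

lemma measure_shrunken_box:
  fixes c :: "real ^ 'n"
  assumes "0 < s" "0 < r"
  shows "measure lebesgue (cbox (c + r *\<^sub>R One) (c + plate i0 s - r *\<^sub>R One))
     = max 0 (s - r) * (2 * (4 * s - 2 * r) ^ (CARD('n) - 1))"
proof -
  show ?thesis
  proof (cases "r \<le> s")
    case True
    have "measure lebesgue (cbox (c + r *\<^sub>R One) (c + plate i0 s - r *\<^sub>R One)) =
      (\<Prod>i\<in>UNIV. if i = i0 then 2 * s - 2 * r else 4 * s - 2 * r)"
      using True assms
      by (subst measure_completion, simp, subst content_cbox_cart)
        (auto simp: sum_Basis_cart plate_def interval_ne_empty_cart intro!: prod.cong)
    also have "\<dots> = (2 * s - 2 * r) * (\<Prod>i\<in>UNIV - {i0}. if i = i0 then 2 * s - 2 * r else 4 * s - 2 * r)"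
      by (subst prod.remove[of _ i0]) auto
    also have "(\<Prod>i\<in>UNIV - {i0}. if i = i0 then 2 * s - 2 * r else 4 * s - 2 * r)
       = (\<Prod>i\<in>UNIV - {i0}. 4 * s - 2 * r)"
      by (intro prod.cong) auto
    finally show ?thesis using True by (simp add: card_Diff_singleton)
  next
    case False
    then have "x \<notin> cbox (c + r *\<^sub>R One) (c + plate i0 s - r *\<^sub>R One)" for x
      by (auto simp: mem_box_cart plate_def sum_Basis_cart intro!: exI[of _ i0])
    then have "cbox (c + r *\<^sub>R One) (c + plate i0 s - r *\<^sub>R One) = {}" by blast
    then show ?thesis using False by simp
  qed
qed

text \<open>
  The lower bound \<open>e\<close> on \<open>r\<close> makes the index set of the sum independent of \<open>r\<close>, so that the formula
  expresses the parallel volume on \<open>{e..}\<close> through finitely many fixed functions of \<open>r\<close>.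
\<close>

lemma parallel_volume_ball_minus_boxes:
  fixes c :: "real \<Rightarrow> real ^ 'n"
  assumes R: "0 \<le> R" and N: "N \<subseteq> {0<..}" and e: "0 < e" "e \<le> r" and fin: "finite {s\<in>N. e \<le> s}"
    and sub: "\<And>s. s \<in> N \<Longrightarrow> cbox (c s) (c s + plate i0 s) \<subseteq> ball 0 R"
    and disj: "disjoint_family_on (\<lambda>s. box (c s) (c s + plate i0 s)) N"
  shows "parallel_volume (cball 0 R - (\<Union>s\<in>N. box (c s) (c s + plate i0 s))) r
    = unit_ball_vol (CARD('n)) * (R + r) ^ CARD('n)
      - (\<Sum>s\<in>{s\<in>N. e \<le> s}. max 0 (s - r) * (2 * (4 * s - 2 * r) ^ (CARD('n) - 1)))"
proof -
  define I where "I s = cbox (c s + r *\<^sub>R One) (c s + plate i0 s - r *\<^sub>R One)" for s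
  have r: "0 < r" using e by simp
  have ne: "box (c s) (c s + plate i0 s) \<noteq> {}" if "s \<in> N" for s
    using that N by (auto simp: interval_ne_empty_cart plate_def)
  have I_box: "I s \<subseteq> box (c s) (c s + plate i0 s)" for s
  proof
    fix x
    assume "x \<in> I s"
    then have "c s $ i + r \<le> x $ i \<and> x $ i \<le> c s $ i + plate i0 s $ i - r" for i
      by (simp add: I_def mem_box_cart sum_Basis_cart)
    then have "c s $ i < x $ i \<and> x $ i < c s $ i + plate i0 s $ i" for i
      using r by (smt (verit))
    then show "x \<in> box (c s) (c s + plate i0 s)"
      by (simp add: mem_box_cart)
  qed
  have I_empty: "I s = {}" if "s < e" for s
  proof -
    have "x \<notin> I s" for x
      using that e by (auto simp: I_def mem_box_cart plate_def sum_Basis_cart intro!: exI[of _ i0])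
    then show ?thesis by blast
  qed
  have union: "(\<Union>s\<in>N. I s) = (\<Union>s\<in>{s\<in>N. e \<le> s}. I s)"
    using I_empty not_le by fastforce
  have "parallel_volume (cball 0 R - (\<Union>s\<in>N. box (c s) (c s + plate i0 s))) r
     = measure lebesgue (ball 0 (R + r) - (\<Union>s\<in>{s\<in>N. e \<le> s}. I s))"
    unfolding parallel_volume_def union[symmetric]
    unfolding I_def by (intro arg_cong[of _ _ "measure lebesgue"] parallel_set_ball_minus_boxes(3)[OF R r sub ne disj])
  also have "\<dots> = measure lebesgue (ball (0 :: real ^ 'n) (R + r)) - measure lebesgue (\<Union>s\<in>{s\<in>N. e \<le> s}. I s)"
  proof (rule measurable_measure_Diff)
    have "I s \<subseteq> ball 0 (R + r)" if "s \<in> N" for s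
      using I_box[of s] sub[OF that] box_subset_cbox subset_ball[of R "R + r"] r by fastforce
    then show "(\<Union>s\<in>{s\<in>N. e \<le> s}. I s) \<subseteq> ball 0 (R + r)" by blast
    show "(\<Union>s\<in>{s\<in>N. e \<le> s}. I s) \<in> sets lebesgue"
      using fin by (intro sets.finite_UN) (auto simp: I_def)
  qed simp
  also have "measure lebesgue (ball (0 :: real ^ 'n) (R + r)) = unit_ball_vol (CARD('n)) * (R + r) ^ CARD('n)"
    using R r content_ball[of "R + r" "0 :: real ^ 'n"] by simp
  also have "measure lebesgue (\<Union>s\<in>{s\<in>N. e \<le> s}. I s) = (\<Sum>s\<in>{s\<in>N. e \<le> s}. measure lebesgue (I s))"
  proof (rule measure_finite_Union[OF fin])
    show "disjoint_family_on I {s\<in>N. e \<le> s}"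
      using disj I_box unfolding disjoint_family_on_def by fast
  qed (auto simp: I_def emeasure_lborel_cbox_eq)
  also have "\<dots> = (\<Sum>s\<in>{s\<in>N. e \<le> s}. max 0 (s - r) * (2 * (4 * s - 2 * r) ^ (CARD('n) - 1)))"
    using N r unfolding I_def by (intro sum.cong refl measure_shrunken_box) auto
  finally show ?thesis .
qed

section \<open>Packing cubes of finite total volume\<close>

lemma finite_large_of_bounded_power_sums:
  fixes a :: "'a \<Rightarrow> real"
  assumes e: "0 < e"
    and bd: "\<And>F. finite F \<Longrightarrow> F \<subseteq> A \<Longrightarrow> (\<Sum>s\<in>F. a s ^ d) \<le> B"
  shows "finite {s\<in>A. e \<le> a s}"
proof (rule ccontr)
  assume inf: "infinite {s\<in>A. e \<le> a s}"
  obtain n :: nat where n: "B / e ^ d < real n"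
    using reals_Archimedean2 by blast
  obtain F where F: "finite F" "card F = n" "F \<subseteq> {s\<in>A. e \<le> a s}"
    using infinite_arbitrarily_large[OF inf] by blast
  have "real n * e ^ d = (\<Sum>s\<in>F. e ^ d)"
    using F by simp
  also have "\<dots> \<le> (\<Sum>s\<in>F. a s ^ d)"
    using F e by (intro sum_mono power_mono) auto
  also have "\<dots> \<le> B"
    using F by (intro bd) auto
  finally show False
    using n e by (simp add: field_simps)
qed

text \<open>
  Let \<open>L\<close> bound all edge lengths, and let the \<open>k\<close>-th class \<open>S k\<close> consist of the cubes whose edge
  length lies in \<open>{L / 2 ^ Suc k<..L / 2 ^ k}\<close>. The cubes of a class are placed in the cells of a
  cubical grid of mesh \<open>L / 2 ^ k\<close>. The grid has \<open>2 ^ k\<close> cells in every direction except one, \<open>i0\<close>,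
  in which it has \<open>m k\<close> cells, enough to hold the class. These slabs of width \<open>L\<close> are stacked
  in direction \<open>i0\<close>. The thickness of the \<open>k\<close>-th slab is at most a constant times the volume of its
  class, plus one mesh \<open>L / 2 ^ k\<close> for rounding up; both terms have bounded sums over \<open>k\<close>.
\<close>

lemma cube_packing:
  fixes a :: "'a \<Rightarrow> real"
  assumes pos: "\<And>s. s \<in> A \<Longrightarrow> 0 < a s"
    and bd: "\<And>F. finite F \<Longrightarrow> F \<subseteq> A \<Longrightarrow> (\<Sum>s\<in>F. a s ^ CARD('n::finite)) \<le> B"
  obtains c :: "'a \<Rightarrow> real ^ 'n"
  where "bounded (\<Union>s\<in>A. cbox (c s) (c s + (\<chi> i. a s)))"
    and "disjoint_family_on (\<lambda>s. box (c s) (c s + (\<chi> i. a s))) A"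
proof -
  define d where "d = CARD('n)"
  define L where "L = B + 1"
  define q where "q k = L / 2 ^ k" for k :: nat
  have "0 \<le> B" using bd[of "{}"] by simp
  then have L: "1 \<le> L" by (simp add: L_def)
  have q: "0 < q k" for k using L by (simp add: q_def)
  have aL: "a s \<le> L" if "s \<in> A" for s
  proof (cases "a s \<le> 1")
    case False
    then have "a s ^ 1 \<le> a s ^ d"
      by (intro power_increasing) (auto simp: d_def Suc_le_eq)
    also have "\<dots> \<le> B" using bd[of "{s}"] that by (simp add: d_def)
    finally show ?thesis by (simp add: L_def)
  qed (use L in simp)

  define S where "S k = {s \<in> A. q (Suc k) < a s \<and> a s \<le> q k}" for k
  have finS: "finite (S k)" for k
    by (rule finite_subset[OF _ finite_large_of_bounded_power_sums[OF q[of "Suc k"] bd]])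
      (auto simp: S_def)
  have "\<exists>k. s \<in> S k" if s: "s \<in> A" for s
  proof -
    define k where "k = (LEAST k. q (Suc k) < a s)"
    obtain n :: nat where n: "L / a s < 2 ^ n"
      using real_arch_pow[of 2 "L / a s"] by auto
    have "q (Suc n) < a s"
    proof -
      have "L < a s * 2 ^ n" using n pos[OF s] by (simp add: field_simps)
      also have "\<dots> \<le> a s * 2 ^ Suc n" using pos[OF s] by simp
      finally show ?thesis by (simp add: q_def field_simps)
    qed
    then have k: "q (Suc k) < a s" unfolding k_def by (rule LeastI)
    have "a s \<le> q k"
    proof (cases k)
      case 0
      then show ?thesis using aL[OF s] by (simp add: q_def)
    next
      case (Suc j)
      then have "\<not> q (Suc j) < a s"
        using not_less_Least[of j "\<lambda>k. q (Suc k) < a s"] by (simp add: k_def)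
      then show ?thesis using Suc by simp
    qed
    with k s show ?thesis by (auto simp: S_def)
  qed
  then obtain \<kappa> where \<kappa>: "\<And>s. s \<in> A \<Longrightarrow> s \<in> S (\<kappa> s)" by metis
  have q_anti: "q j \<le> q i" if "i \<le> j" for i j
    using L that by (auto simp: q_def intro!: divide_left_mono power_increasing)
  have S_disj: "S i \<inter> S j = {}" if "i < j" for i j
    using q_anti[of "Suc i" j] that by (force simp: S_def)

  \<comment> \<open>\<open>T k\<close> is the total thickness of the slabs before the \<open>k\<close>-th, and \<open>M\<close> bounds all of them.\<close>
  define m where "m k = card (S k) div 2 ^ (k * (d - 1)) + 1" for k
  define T where "T k = (\<Sum>j<k. real (m j) * q j)" for k
  define M where "M = L * (2 / L) ^ d * B + 2 * L"
  have slab: "real (m k) * q k \<le> L * (2 / L) ^ d * (\<Sum>s\<in>S k. a s ^ d) + q k" for k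
  proof -
    have d: "d = Suc (d - 1)" by (simp add: d_def)
    have "real (card (S k) div 2 ^ (k * (d - 1))) \<le> real (card (S k)) / 2 ^ (k * (d - 1))"
      using of_nat_div_le_of_nat[of "card (S k)" "2 ^ (k * (d - 1))", where 'a=real] by simp
    then have "real (card (S k) div 2 ^ (k * (d - 1))) * q k
        \<le> real (card (S k)) / 2 ^ (k * (d - 1)) * q k"
      using q[of k] by (intro mult_right_mono) auto
    also have "\<dots> = L * (2 / L) ^ d * (real (card (S k)) * q (Suc k) ^ d)"
    proof -
      have "(2 / L) ^ d * q (Suc k) ^ d = (1 / 2 ^ k) ^ d"
        unfolding power_mult_distrib[symmetric] using L by (simp add: q_def)
      also have "\<dots> = 1 / (2 ^ (k * (d - 1)) * 2 ^ k)"
        by (subst d) (simp add: power_one_over power_mult field_simps)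
      finally have *: "(2 / L) ^ d * q (Suc k) ^ d = 1 / (2 ^ (k * (d - 1)) * 2 ^ k)" .
      have "L * (2 / L) ^ d * (real (card (S k)) * q (Suc k) ^ d)
         = L * real (card (S k)) * ((2 / L) ^ d * q (Suc k) ^ d)" by (simp only: mult_ac)
      also have "\<dots> = real (card (S k)) / 2 ^ (k * (d - 1)) * q k"
        unfolding * by (simp add: q_def)
      finally show ?thesis by simp
    qed
    also have "real (card (S k)) * q (Suc k) ^ d \<le> (\<Sum>s\<in>S k. a s ^ d)"
    proof -
      have "(\<Sum>s\<in>S k. q (Suc k) ^ d) \<le> (\<Sum>s\<in>S k. a s ^ d)"
        using q[of "Suc k"] by (intro sum_mono power_mono) (auto simp: S_def)
      then show ?thesis by simp
    qed
    finally show ?thesis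
      using L by (simp add: m_def algebra_simps)
  qed
  have T_le: "T k \<le> M" for k
  proof -
    have "T k \<le> (\<Sum>j<k. L * (2 / L) ^ d * (\<Sum>s\<in>S j. a s ^ d) + q j)"
      unfolding T_def by (intro sum_mono slab)
    also have "\<dots> = L * (2 / L) ^ d * (\<Sum>j<k. \<Sum>s\<in>S j. a s ^ d) + L * (\<Sum>j<k. (1/2) ^ j)"
      by (simp add: sum.distrib sum_distrib_left[symmetric] q_def power_one_over)
        (simp add: sum_distrib_left)
    also have "(\<Sum>j<k. \<Sum>s\<in>S j. a s ^ d) = (\<Sum>s\<in>(\<Union>j<k. S j). a s ^ d)"
      using finS S_disj by (intro sum.UNION_disjoint[symmetric]) (auto simp: neq_iff Int_commute)
    also have "\<dots> \<le> B"
      unfolding d_def using finS by (intro bd) (auto simp: S_def)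
    also have "(\<Sum>j<k. (1/2::real) ^ j) \<le> 2"
      by (simp add: geometric_sum)
    finally show ?thesis
      using L by (simp add: M_def mult_left_mono)
  qed
  have T_mono: "T (Suc i) \<le> T j" if "i < j" for i j
    unfolding T_def using that q by (intro sum_mono2) (auto intro!: mult_nonneg_nonneg less_imp_le[OF q])
  have T_nonneg: "0 \<le> T k" for k
    unfolding T_def using q by (intro sum_nonneg) (auto intro!: mult_nonneg_nonneg less_imp_le[OF q])

  define i0 :: 'n where "i0 = undefined"
  \<comment> \<open>\<open>P k\<close> is the set of cells of the \<open>k\<close>-th slab; \<open>f k\<close> assigns distinct cells to the cubes of its
    class.\<close>
  define P where "P k = (\<Pi>\<^sub>E i\<in>(UNIV :: 'n set). if i = i0 then {..<m k} else {..<2 ^ k :: nat})" for k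
  have finP: "finite (P k)" for k
    unfolding P_def by (intro finite_PiE) auto
  have "card (S k) \<le> card (P k)" for k
  proof -
    have "card (P k) = (\<Prod>i\<in>(UNIV::'n set). if i = i0 then m k else 2 ^ k)"
      unfolding P_def by (subst card_PiE) (auto intro!: prod.cong)
    also have "\<dots> = m k * (\<Prod>i\<in>UNIV - {i0}. if i = i0 then m k else 2 ^ k)"
      by (subst prod.remove[of _ i0]) auto
    also have "(\<Prod>i\<in>UNIV - {i0}. if i = i0 then m k else 2 ^ k) = (\<Prod>i\<in>UNIV - {i0}. 2 ^ k)"
      by (intro prod.cong) auto
    also have "\<dots> = 2 ^ (k * (d - 1))"
      by (simp add: d_def card_Diff_singleton power_mult)
    finally have "card (P k) = m k * 2 ^ (k * (d - 1))" .
    moreover have "card (S k) \<le> m k * 2 ^ (k * (d - 1))"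
      unfolding m_def using dividend_less_div_times[of "2 ^ (k * (d - 1))" "card (S k)"] by simp
    ultimately show ?thesis by simp
  qed
  then have "\<exists>f. f ` S k \<subseteq> P k \<and> inj_on f (S k)" for k
    using card_le_inj finS finP by blast
  then obtain f where f: "\<And>k. f k ` S k \<subseteq> P k" "\<And>k. inj_on (f k) (S k)" by metis

  define c :: "'a \<Rightarrow> real ^ 'n" where
    "c s = (\<chi> i. (if i = i0 then T (\<kappa> s) else 0) + real (f (\<kappa> s) s i) * q (\<kappa> s))" for s
  have f_less: "f (\<kappa> s) s i < (if i = i0 then m (\<kappa> s) else 2 ^ \<kappa> s)" if "s \<in> A" for s i
  proof -
    have "f (\<kappa> s) s \<in> P (\<kappa> s)" using f(1)[of "\<kappa> s"] \<kappa>[OF that] by blast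
    then have "f (\<kappa> s) s i \<in> (if i = i0 then {..<m (\<kappa> s)} else {..<2 ^ \<kappa> s})"
      unfolding P_def by (rule PiE_mem) simp
    then show ?thesis by (auto split: if_splits)
  qed
  have a_le: "a s \<le> q (\<kappa> s)" if "s \<in> A" for s
    using \<kappa>[OF that] by (simp add: S_def)
  have c_slab: "T (\<kappa> s) \<le> c s $ i0 \<and> c s $ i0 + a s \<le> T (Suc (\<kappa> s))" if "s \<in> A" for s
  proof -
    have "real (f (\<kappa> s) s i0 + 1) * q (\<kappa> s) \<le> real (m (\<kappa> s)) * q (\<kappa> s)"
      using f_less[OF that, of i0] q[of "\<kappa> s"] by (intro mult_right_mono) (auto simp: less_imp_le)
    then show ?thesis
      using a_le[OF that] q[of "\<kappa> s"] by (simp add: c_def T_def algebra_simps)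
  qed
  have c_side: "0 \<le> c s $ i \<and> c s $ i + a s \<le> L" if "s \<in> A" "i \<noteq> i0" for s i
  proof -
    have "real (f (\<kappa> s) s i + 1) * q (\<kappa> s) \<le> real (2 ^ \<kappa> s) * q (\<kappa> s)"
      using f_less[OF that(1), of i] that(2) q[of "\<kappa> s"]
      by (intro mult_right_mono) (auto simp: less_imp_le simp del: of_nat_power)
    also have "\<dots> = L" by (simp add: q_def)
    finally show ?thesis
      using a_le[OF that(1)] q[of "\<kappa> s"] that(2) by (simp add: c_def algebra_simps)
  qed
  have "bounded (\<Union>s\<in>A. cbox (c s) (c s + (\<chi> i. a s)))"
  proof (rule bounded_subset[OF bounded_cbox])
    show "(\<Union>s\<in>A. cbox (c s) (c s + (\<chi> i. a s))) \<subseteq> cbox 0 (\<chi> i. max M L)"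
    proof (intro UN_least subsetI)
      fix s x
      assume s: "s \<in> A" and x: "x \<in> cbox (c s) (c s + (\<chi> i. a s))"
      have "0 \<le> x $ i \<and> x $ i \<le> max M L" for i
      proof -
        have "c s $ i \<le> x $ i" "x $ i \<le> c s $ i + a s"
          using x by (auto simp: mem_box_cart)
        then show ?thesis
          using c_slab[OF s] c_side[OF s, of i] T_nonneg[of "\<kappa> s"] T_le[of "Suc (\<kappa> s)"]
          by (cases "i = i0") auto
      qed
      then show "x \<in> cbox 0 (\<chi> i. max M L)" by (simp add: mem_box_cart)
    qed
  qed
  moreover have "disjoint_family_on (\<lambda>s. box (c s) (c s + (\<chi> i. a s))) A"
    unfolding disjoint_family_on_def
  proof (intro ballI impI)
    \<comment> \<open>Different classes are separated in direction \<open>i0\<close>, different cells of one slab in some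
      direction \<open>i\<close>.\<close>
    have slabs: False
      if "s \<in> A" "t \<in> A" "\<kappa> s < \<kappa> t" "x \<in> box (c s) (c s + (\<chi> i. a s))" "x \<in> box (c t) (c t + (\<chi> i. a t))"
      for s t x
      using c_slab[of s] c_slab[of t] T_mono[of "\<kappa> s" "\<kappa> t"] that
        by (fastforce simp: mem_box_cart dest!: spec[of _ i0])
    have cells: False
      if "s \<in> A" "t \<in> A" "\<kappa> s = \<kappa> t" "f (\<kappa> s) s i < f (\<kappa> t) t i"
        "x \<in> box (c s) (c s + (\<chi> i. a s))" "x \<in> box (c t) (c t + (\<chi> i. a t))"
      for s t x i
    proof -
      have "real (f (\<kappa> s) s i + 1) * q (\<kappa> s) \<le> real (f (\<kappa> t) t i) * q (\<kappa> s)"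
        using that(4) q[of "\<kappa> s"] by (intro mult_right_mono) (auto simp: less_imp_le)
      then have "c s $ i + a s \<le> c t $ i"
        using a_le[OF that(1)] that(3) by (cases "i = i0") (simp_all add: c_def algebra_simps)
      moreover have "x $ i < c s $ i + a s" "c t $ i < x $ i"
        using that(5,6) by (auto simp: mem_box_cart)
      ultimately show False by linarith
    qed
    fix s t
    assume st: "s \<in> A" "t \<in> A" "s \<noteq> t"
    show "box (c s) (c s + (\<chi> i. a s)) \<inter> box (c t) (c t + (\<chi> i. a t)) = {}"
    proof (cases "\<kappa> s = \<kappa> t")
      case True
      then have "f (\<kappa> s) s \<noteq> f (\<kappa> t) t"
        using inj_onD[OF f(2)[of "\<kappa> s"], of s t] \<kappa>[OF st(1)] \<kappa>[OF st(2)] st(3) by auto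
      then obtain i where "f (\<kappa> s) s i \<noteq> f (\<kappa> t) t i" by auto
      then show ?thesis
        using cells[of s t i] cells[of t s i] True st by (metis disjoint_iff linorder_neqE_nat)
    next
      case False
      then show ?thesis
        using slabs[of s t] slabs[of t s] st by (metis disjoint_iff linorder_neqE_nat)
    qed
  qed
  ultimately show thesis using that by blast
qed

section \<open>Prescribing the radii of non-differentiability\<close>

theorem proposition5p3:
  fixes N :: "real set"
  assumes "N \<subseteq> {0<..}"
    and "(SUP F\<in>{F. finite F \<and> F \<subseteq> N}. ereal (\<Sum>s\<in>F. s ^ CARD('n::finite))) < \<infinity>"
  shows "\<exists>C :: (real ^ 'n) set. C \<noteq> {} \<and> compact C \<and> nondiff_radii C = N"
proof -
  obtain B where "(SUP F\<in>{F. finite F \<and> F \<subseteq> N}. ereal (\<Sum>s\<in>F. s ^ CARD('n))) < ereal B"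
    using less_PInf_Ex_of_nat assms(2) by auto
  then have B: "(\<Sum>s\<in>F. s ^ CARD('n)) \<le> B" if "finite F" "F \<subseteq> N" for F
    using that SUP_lessD[of "\<lambda>F. ereal (\<Sum>s\<in>F. s ^ CARD('n))"] by fastforce
  have fin: "finite {s\<in>N. e \<le> s}" if "0 < e" for e
    using finite_large_of_bounded_power_sums[of e N "\<lambda>s. s"] B that by blast
  have bd: "(\<Sum>s\<in>F. (4 * s) ^ CARD('n)) \<le> 4 ^ CARD('n) * B" if "finite F" "F \<subseteq> N" for F
    using B[OF that] by (simp add: power_mult_distrib flip: sum_distrib_left)
  obtain c :: "real \<Rightarrow> real ^ 'n"
    where bounded: "bounded (\<Union>s\<in>N. cbox (c s) (c s + (\<chi> i. 4 * s)))"
      and cubes: "disjoint_family_on (\<lambda>s. box (c s) (c s + (\<chi> i. 4 * s))) N"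
  proof (rule cube_packing[of N "\<lambda>s. 4 * s", OF _ bd])
    show "0 < 4 * s" if "s \<in> N" for s :: real using that assms(1) by auto
  qed
  obtain R where R: "0 < R" "(\<Union>s\<in>N. cbox (c s) (c s + (\<chi> i. 4 * s))) \<subseteq> ball 0 R"
    using bounded_subset_ballD[OF bounded] by blast

  define i0 :: 'n where "i0 = undefined"
  have plate_le: "plate i0 s $ i \<le> 4 * s" if "s \<in> N" for s i
    using that assms(1) by (auto simp: plate_def)
  have sub: "cbox (c s) (c s + plate i0 s) \<subseteq> ball 0 R" if "s \<in> N" for s
  proof -
    have "cbox (c s) (c s + plate i0 s) \<subseteq> cbox (c s) (c s + (\<chi> i. 4 * s))"
      using plate_le[OF that] by (auto simp: mem_box_cart) (smt (verit))
    then show ?thesis using R(2) that by blast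
  qed
  have "box (c s) (c s + plate i0 s) \<subseteq> box (c s) (c s + (\<chi> i. 4 * s))" if "s \<in> N" for s
    using plate_le[OF that] by (auto simp: mem_box_cart) (smt (verit))
  then have disj: "disjoint_family_on (\<lambda>s. box (c s) (c s + plate i0 s)) N"
    using cubes unfolding disjoint_family_on_def by (meson disjoint_iff subsetD)
  have ne: "box (c s) (c s + plate i0 s) \<noteq> {}" if "s \<in> N" for s
    using that assms(1) by (auto simp: interval_ne_empty_cart plate_def)
  define C where "C = cball 0 R - (\<Union>s\<in>N. box (c s) (c s + plate i0 s))"
  have C: "C \<noteq> {}" "compact C"
    unfolding C_def using parallel_set_ball_minus_boxes(1,2)[OF _ zero_less_one sub ne disj] R(1) by auto

  define h where "h s r = 2 * (4 * s - 2 * r) ^ (CARD('n) - 1)" for s r :: real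
  have "parallel_volume C differentiable (at r) \<longleftrightarrow> r \<notin> N" if r: "0 < r" for r
  proof -
    \<comment> \<open>\<open>W\<close> collects everything except the contribution of the hole belonging to \<open>r\<close> itself.\<close>
    define F where "F = {s\<in>N. r / 2 \<le> s}"
    define g where "g s \<rho> = max 0 (s - \<rho>) * h s \<rho>" for s \<rho>
    define W where "W \<rho> = unit_ball_vol (CARD('n)) * (R + \<rho>) ^ CARD('n) - (\<Sum>s\<in>F - {r}. g s \<rho>)" for \<rho>
    have finF: "finite F" using fin[of "r / 2"] r by (simp add: F_def)
    have V: "parallel_volume C \<rho> = W \<rho> - (if r \<in> N then g r \<rho> else 0)" if "r / 2 < \<rho>" for \<rho>
    proof -
      have "parallel_volume C \<rho> = unit_ball_vol (CARD('n)) * (R + \<rho>) ^ CARD('n) - (\<Sum>s\<in>F. g s \<rho>)"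
        using parallel_volume_ball_minus_boxes[OF _ assms(1) _ _ fin sub disj, of "r / 2" \<rho>] R(1) r that
        by (simp add: C_def F_def g_def h_def)
      moreover have "(\<Sum>s\<in>F. g s \<rho>) = (\<Sum>s\<in>F - {r}. g s \<rho>) + (if r \<in> N then g r \<rho> else 0)"
        using sum.remove[OF finF, of r "\<lambda>s. g s \<rho>"] r by (auto simp: F_def)
      ultimately show ?thesis by (simp add: W_def)
    qed
    have near: "r / 2 < \<rho>" if "dist \<rho> r < r / 2" for \<rho>
      using that unfolding dist_real_def by linarith
    have h_diff: "h s differentiable (at r)" for s
      unfolding h_def by (intro derivative_intros)
    have g_diff: "g s differentiable (at r)" if "s \<noteq> r" for s
    proof (cases "s < r")
      case True
      show ?thesis
        by (rule differentiable_transform_within[where f = "\<lambda>_. 0" and d = "r - s"])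
          (use True in \<open>auto simp: g_def dist_real_def\<close>)
    next
      case False
      show ?thesis
      proof (rule differentiable_transform_within[where f = "\<lambda>\<rho>. (s - \<rho>) * h s \<rho>" and d = "s - r"])
        show "(\<lambda>\<rho>. (s - \<rho>) * h s \<rho>) differentiable (at r)"
          by (intro derivative_intros h_diff)
      qed (use False that in \<open>auto simp: g_def dist_real_def\<close>)
    qed
    have W: "W differentiable (at r)"
      unfolding W_def using finF by (intro derivative_intros g_diff) (auto intro: g_diff)
    show ?thesis
    proof (cases "r \<in> N")
      case False
      have "parallel_volume C differentiable (at r)"
        by (rule differentiable_transform_within[OF W, of "r / 2"]) (use r V near False in auto)
      with False show ?thesis by simp
    next
      case True
      have "\<not> parallel_volume C differentiable (at r)"
      proof
        assume "parallel_volume C differentiable (at r)"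
        then have "(\<lambda>\<rho>. W \<rho> - parallel_volume C \<rho>) differentiable (at r)"
          using W by (intro differentiable_diff)
        then have "g r differentiable (at r)"
          by (rule differentiable_transform_within[where d = "r / 2"]) (use r V near True in auto)
        moreover have "h r r \<noteq> 0" using r by (simp add: h_def)
        moreover have "isCont (h r) r" using h_diff by (rule differentiable_imp_continuous_within)
        ultimately show False
          using not_differentiable_kink[of r "h r"] by (simp add: g_def[abs_def])
      qed
      with True show ?thesis by simp
    qed
  qed
  moreover have "0 < r" if "r \<in> N" for r using assms(1) that by auto
  ultimately have "nondiff_radii C = N"
    by (auto simp: nondiff_radii_def)
  with C show ?thesis by blast
qed

end
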